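(* Let $f_1,\dots,f_m\in C^1(\mathbb{R}^n)$ be such that $\|\nabla f_i(x)-\nabla f_i(y)\|\le L_i\|x-y\|$ for all $x,y\in\mathbb{R}^n$ and all $i$, with $L_i\ge 0$. Let $\tau>0$, $\delta>0$, $z_k=(x_k,t_k)\in\mathbb{R}^n\times\mathbb{R}$, and $g_k=\nabla\Phi_\tau(z_k)$. Then for every $d=(p,\eta)\in\mathbb{R}^{n}\times\mathbb{R}$, $$\Phi_\tau(z_k+d)\le \Phi_\tau(z_k)+g_k^Td+\tfrac12 d^TP_kd .$$
   Context: Norms and inner products are Euclidean. $\bar L=\sum_{i=1}^m L_i$. Hyperbolic smoothing: $\phi_\tau(r)=\frac{r+\sqrt{r^2+\tau^2}}{2}$ for $r\in\mathbb{R}$, and $\Phi_\tau(x,t)=t+\sum_{i=1}^m\phi_\tau(f_i(x)-t)$ for $(x,t)\in\mathbb{R}^{n+1}$. At $z_k=(x_k,t_k)$ put $r_{i,k}=f_i(x_k)-t_k$, $\omega_{i,k}=\sqrt{r_{i,k}^2+\tau^2}$; $J_k$ is the $m\times(n+1)$ matrix whose $i$-th row is $(\nabla f_i(x_k)^T,\,-1)$; $D_k=\operatorname{diag}(\omega_{1,k}^{-1},\dots,\omega_{m,k}^{-1})$; $\Pi_x=\operatorname{diag}(I_n,0)\in\mathbb{R}^{(n+1)\times(n+1)}$. The metric is $P_k=\delta I_{n+1}+\bar L\,\Pi_x+\frac12J_k^TD_kJ_k$. *)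

theory Defs
  imports "HOL-Analysis.Analysis"
begin

text \<open>
  The space of pairs of a vector in \<open>real ^ 'n\<close> and a real number is modelled as
  \<open>real ^ 'n option\<close>: the coordinates \<open>Some j\<close> carry the vector and the coordinate
  \<open>None\<close> carries the real number. Its dimension is \<open>CARD('n) + 1\<close>.
\<close>

definition join :: "real ^ 'n::finite \<Rightarrow> real \<Rightarrow> real ^ 'n option" where
  "join x t = (\<chi> k. case k of Some j \<Rightarrow> x $ j | None \<Rightarrow> t)"

definition xpart :: "real ^ ('n::finite) option \<Rightarrow> real ^ 'n" where
  "xpart z = (\<chi> j. z $ Some j)"

definition tpart :: "real ^ ('n::finite) option \<Rightarrow> real" where
  "tpart z = z $ None"

lemma join_nth [simp]: "join x t $ Some j = x $ j" "join x t $ None = t"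
  by (simp_all add: join_def)

lemma xpart_join [simp]: "xpart (join x t) = x"
  by (simp add: xpart_def)

lemma tpart_join [simp]: "tpart (join x t) = t"
  by (simp add: tpart_def)

text \<open>The value of \<open>grad f x\<close> is only meaningful where \<open>f\<close> is differentiable.\<close>

definition grad :: "('a::real_inner \<Rightarrow> real) \<Rightarrow> 'a \<Rightarrow> 'a" where
  "grad f x = (THE D. GDERIV f x :> D)"

lemma grad_eqI:
  assumes "GDERIV f x :> D"
  shows "grad f x = D"
  unfolding grad_def
proof (rule the_equality)
  show "GDERIV f x :> D" by (fact assms)
next
  fix E assume "GDERIV f x :> E"
  then have "(\<lambda>h. h \<bullet> E) = (\<lambda>h. h \<bullet> D)"
    using assms unfolding gderiv_def by (rule has_derivative_unique)
  then have "(E - D) \<bullet> (E - D) = 0"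
    by (metis inner_diff_right right_minus_eq)
  then show "E = D" by simp
qed

lemma GDERIV_grad:
  fixes f :: "'a::euclidean_space \<Rightarrow> real"
  assumes "f differentiable (at x)"
  shows "GDERIV f x :> grad f x"
proof -
  obtain F where F: "(f has_derivative F) (at x)"
    using assms unfolding differentiable_def by blast
  then interpret F: bounded_linear F by (rule has_derivative_bounded_linear)
  have "F = (\<lambda>h. h \<bullet> adjoint F 1)"
    using adjoint_works[OF F.linear, of _ 1] by (auto simp: fun_eq_iff)
  then have "GDERIV f x :> adjoint F 1" using F unfolding gderiv_def by metis
  then show ?thesis using grad_eqI by metis
qed

definition C1 :: "('a::euclidean_space \<Rightarrow> real) \<Rightarrow> bool" where
  "C1 f \<longleftrightarrow> f differentiable_on UNIV \<and> continuous_on UNIV (grad f)"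

definition smooth_plus :: "real \<Rightarrow> real \<Rightarrow> real" where
  "smooth_plus \<tau> r = (r + sqrt (r\<^sup>2 + \<tau>\<^sup>2)) / 2"

definition Phi :: "('m::finite \<Rightarrow> real ^ 'n \<Rightarrow> real) \<Rightarrow> real \<Rightarrow> real ^ ('n::finite) option \<Rightarrow> real" where
  "Phi f \<tau> z = tpart z + (\<Sum>i\<in>UNIV. smooth_plus \<tau> (f i (xpart z) - tpart z))"

definition diag :: "('k \<Rightarrow> real) \<Rightarrow> real ^ 'k ^ 'k" where
  "diag a = (\<chi> i j. if i = j then a i else 0)"

definition residual :: "('m \<Rightarrow> real ^ 'n \<Rightarrow> real) \<Rightarrow> real ^ ('n::finite) option \<Rightarrow> 'm \<Rightarrow> real" where
  "residual f z i = f i (xpart z) - tpart z"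

definition omega :: "('m \<Rightarrow> real ^ 'n \<Rightarrow> real) \<Rightarrow> real \<Rightarrow> real ^ ('n::finite) option \<Rightarrow> 'm \<Rightarrow> real" where
  "omega f \<tau> z i = sqrt ((residual f z i)\<^sup>2 + \<tau>\<^sup>2)"

definition Jmat :: "('m \<Rightarrow> real ^ 'n \<Rightarrow> real) \<Rightarrow> real ^ ('n::finite) option \<Rightarrow> real ^ ('n::finite) option ^ 'm" where
  "Jmat f z = (\<chi> i. join (grad (f i) (xpart z)) (- 1))"

definition Dmat :: "('m \<Rightarrow> real ^ 'n \<Rightarrow> real) \<Rightarrow> real \<Rightarrow> real ^ ('n::finite) option \<Rightarrow> real ^ 'm ^ 'm" where
  "Dmat f \<tau> z = diag (\<lambda>i. inverse (omega f \<tau> z i))"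

definition Pi_x :: "real ^ ('n::finite) option ^ ('n::finite) option" where
  "Pi_x = diag (\<lambda>k. case k of Some _ \<Rightarrow> 1 | None \<Rightarrow> 0)"

definition Pmat ::
  "('m::finite \<Rightarrow> real ^ 'n \<Rightarrow> real) \<Rightarrow> ('m \<Rightarrow> real) \<Rightarrow> real \<Rightarrow> real \<Rightarrow> real ^ ('n::finite) option
    \<Rightarrow> real ^ ('n::finite) option ^ ('n::finite) option" where
  "Pmat f L \<tau> \<delta> z =
     \<delta> *\<^sub>R mat 1 + (\<Sum>i\<in>UNIV. L i) *\<^sub>R Pi_x
     + (1/2) *\<^sub>R (transpose (Jmat f z) ** Dmat f \<tau> z ** Jmat f z)"

end

theory Submission
  imports Defs
begin

text \<open>
  Each summand of \<open>Phi\<close> is the smoothed positive part of a residual \<open>f i x - t\<close>, and the proof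
  majorizes it in two independent ways, one for each curvature term of the metric.

  Put \<open>r = f i x - t\<close> and let \<open>s = grad (f i) x \<bullet> p - \<eta>\<close> be the linearized change of the
  residual along the step \<open>(p, \<eta>)\<close>. Since the gradient of \<open>f i\<close> is Lipschitz, the descent lemma
  bounds the new residual by \<open>r + s + L i / 2 * \<parallel>p\<parallel>\<^sup>2\<close>. The function \<open>smooth_plus \<tau>\<close> is nondecreasing
  and nonexpansive, so the excess \<open>L i / 2 * \<parallel>p\<parallel>\<^sup>2\<close> passes through it at no more than its own size;
  summed over \<open>i\<close>, it is the contribution of \<open>Pi_x\<close>.

  What remains is \<open>smooth_plus \<tau> (r + s)\<close>. Concavity of the square root, applied to the argument
  \<open>(r + s)\<^sup>2 + \<tau>\<^sup>2\<close>, gives a quadratic majorant whose curvature \<open>1 / (2 * \<omega>)\<close> depends on the base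
  point only, where \<open>\<omega> = sqrt (r\<^sup>2 + \<tau>\<^sup>2)\<close>. A uniform bound on the second derivative would give
  only \<open>1 / (2 * \<tau>)\<close>, which is larger unless \<open>r = 0\<close>; the concavity argument produces exactly the
  weights of \<open>Dmat\<close>. The quadratic terms \<open>s\<^sup>2 / (4 * \<omega>)\<close> sum to the contribution of \<open>J\<^sup>T D J\<close>,
  because the \<open>s\<close> are the entries of \<open>J d\<close>. The linear terms of the
  majorants add up to the derivative of \<open>Phi\<close>, and the \<open>\<delta>\<close>-part of the metric is nonnegative.
\<close>

section \<open>Scalar smoothing\<close>

text \<open>
  The Euclidean norm of \<open>(r, \<tau>)\<close> changes by at most \<open>\<bar>e\<bar>\<close> when \<open>r\<close> changes by \<open>e\<close>. Averaged with
  \<open>r\<close> itself, it therefore has all its difference quotients in \<open>[0, 1]\<close>; this lemma is the upper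
  bound, the next one the lower bound.
\<close>

lemma smooth_plus_add_le:
  assumes "e \<ge> 0"
  shows "smooth_plus \<tau> (r + e) \<le> smooth_plus \<tau> r + e"
proof -
  have "sqrt ((r + e)\<^sup>2 + (\<tau> + 0)\<^sup>2) \<le> sqrt (r\<^sup>2 + \<tau>\<^sup>2) + sqrt (e\<^sup>2 + 0\<^sup>2)"
    by (rule real_sqrt_sum_squares_triangle_ineq)
  with assms have "sqrt ((r + e)\<^sup>2 + \<tau>\<^sup>2) \<le> sqrt (r\<^sup>2 + \<tau>\<^sup>2) + e" by simp
  then show ?thesis using assms unfolding smooth_plus_def by argo
qed

lemma smooth_plus_mono:
  assumes "r \<le> s"
  shows "smooth_plus \<tau> r \<le> smooth_plus \<tau> s"
proof -
  have "sqrt ((s + (r - s))\<^sup>2 + (\<tau> + 0)\<^sup>2) \<le> sqrt (s\<^sup>2 + \<tau>\<^sup>2) + sqrt ((r - s)\<^sup>2 + 0\<^sup>2)"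
    by (rule real_sqrt_sum_squares_triangle_ineq)
  with assms show ?thesis by (simp add: smooth_plus_def)
qed

text \<open>The graph of the square root lies below its tangent at \<open>r\<^sup>2 + \<tau>\<^sup>2\<close>.\<close>

lemma smooth_plus_quadratic_majorant:
  assumes "\<tau> > 0"
  defines "w \<equiv> \<lambda>r. sqrt (r\<^sup>2 + \<tau>\<^sup>2)"
  shows "smooth_plus \<tau> (r + s) \<le> smooth_plus \<tau> r + (1 + r / w r) / 2 * s + s\<^sup>2 / (4 * w r)"
proof -
  have pos: "w r > 0" using assms by (simp add: add_nonneg_pos)
  have sq: "(w q)\<^sup>2 = q\<^sup>2 + \<tau>\<^sup>2" for q by (simp add: w_def)
  have "2 * w (r + s) * w r \<le> (w (r + s))\<^sup>2 + (w r)\<^sup>2" by (rule sum_squares_bound)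
  also have "\<dots> = 2 * (w r)\<^sup>2 + (2 * r * s + s\<^sup>2)"
    unfolding sq by (simp add: power2_eq_square algebra_simps)
  finally have "w (r + s) \<le> w r + (2 * r * s + s\<^sup>2) / (2 * w r)"
    using pos by (simp add: field_simps power2_eq_square)
  then have "(r + s + w (r + s)) / 2
      \<le> (r + s + (w r + (2 * r * s + s\<^sup>2) / (2 * w r))) / 2"
    by argo
  also have "\<dots> = (r + w r) / 2 + (1 + r / w r) / 2 * s + s\<^sup>2 / (4 * w r)"
    using pos by (simp add: field_simps)
  finally show ?thesis unfolding smooth_plus_def w_def .
qed

lemma smooth_plus_has_field_derivative:
  assumes "\<tau> > 0"
  shows "(smooth_plus \<tau> has_field_derivative (1 + r / sqrt (r\<^sup>2 + \<tau>\<^sup>2)) / 2) (at r)"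
proof -
  have "r\<^sup>2 + \<tau>\<^sup>2 > 0" using assms by (simp add: add_nonneg_pos)
  then have "((\<lambda>r. (r + sqrt (r\<^sup>2 + \<tau>\<^sup>2)) / 2) has_field_derivative
      (1 + r / sqrt (r\<^sup>2 + \<tau>\<^sup>2)) / 2) (at r)"
    by (auto intro!: derivative_eq_intros simp: field_simps)
  then show ?thesis unfolding smooth_plus_def[abs_def] .
qed

section \<open>Gradients and the descent lemma\<close>

lemma grad_inner_eq:
  fixes f :: "'a::euclidean_space \<Rightarrow> real"
  assumes "(f has_derivative F) (at x)"
  shows "grad f x \<bullet> h = F h"
proof -
  have "GDERIV f x :> grad f x"
    using assms by (intro GDERIV_grad) (auto simp: differentiable_def)
  then have "(\<lambda>h. h \<bullet> grad f x) = F"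
    using assms unfolding gderiv_def by (rule has_derivative_unique)
  then show ?thesis by (metis inner_commute)
qed

lemma C1_has_derivative:
  assumes "C1 f"
  shows "(f has_derivative (\<lambda>h. grad f x \<bullet> h)) (at x)"
  using assms GDERIV_grad[of f x]
  by (simp add: C1_def differentiable_on_def gderiv_def inner_commute)

text \<open>
  Along the segment from \<open>x\<close> to \<open>x + p\<close>, the difference between \<open>f\<close> and the claimed quadratic
  majorant starts at \<open>0\<close>; its derivative is nonpositive by Cauchy-Schwarz and the Lipschitz bound.
\<close>

lemma descent_lemma:
  fixes f :: "'a::euclidean_space \<Rightarrow> real"
  assumes "C1 f"
    and lip: "\<And>y y'. norm (grad f y - grad f y') \<le> L * norm (y - y')"
  shows "f (x + p) \<le> f x + grad f x \<bullet> p + L / 2 * (p \<bullet> p)"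
proof -
  define g where
    "g u = f (x + u *\<^sub>R p) - u * (grad f x \<bullet> p) - L / 2 * u\<^sup>2 * (p \<bullet> p)" for u
  define g' where "g' u = (grad f (x + u *\<^sub>R p) - grad f x) \<bullet> p - L * u * (p \<bullet> p)" for u
  have "(g has_field_derivative g' u) (at u)" for u
  proof -
    have "((\<lambda>u. x + u *\<^sub>R p) has_derivative (\<lambda>h. h *\<^sub>R p)) (at u)"
      by (auto intro!: derivative_eq_intros)
    from has_derivative_compose[OF this C1_has_derivative[OF \<open>C1 f\<close>]]
    have "((\<lambda>u. f (x + u *\<^sub>R p)) has_field_derivative grad f (x + u *\<^sub>R p) \<bullet> p) (at u)"
      by (simp add: has_field_derivative_def mult.commute[of _ "_ \<bullet> p"])
    then show ?thesis unfolding g_def[abs_def] g'_def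
      by (auto intro!: derivative_eq_intros simp: inner_diff_left)
  qed
  moreover have "g' u \<le> 0" if "0 \<le> u" for u
  proof -
    have "(grad f (x + u *\<^sub>R p) - grad f x) \<bullet> p
        \<le> norm (grad f (x + u *\<^sub>R p) - grad f x) * norm p"
      by (rule norm_cauchy_schwarz)
    also have "\<dots> \<le> L * norm (x + u *\<^sub>R p - x) * norm p"
      by (intro mult_right_mono lip) simp
    also have "\<dots> = L * u * (p \<bullet> p)"
      using that by (simp add: power2_norm_eq_inner[symmetric] power2_eq_square)
    finally show ?thesis by (simp add: g'_def)
  qed
  ultimately have "g 1 \<le> g 0"
    by (intro DERIV_nonpos_imp_nonincreasing[of 0 1 g]) auto
  then show ?thesis by (simp add: g_def)
qed

section \<open>Coordinates and quadratic forms\<close>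

lemma inner_xpart_tpart: "z \<bullet> w = xpart z \<bullet> xpart w + tpart z * tpart w"
  by (simp add: inner_vec_def xpart_def tpart_def UNIV_option_conv sum.reindex)

lemma xpart_nth: "xpart z $ j = z $ Some j"
  by (simp add: xpart_def)

lemma xpart_add: "xpart (z + w) = xpart z + xpart w"
  by (simp add: xpart_def vec_eq_iff)

lemma tpart_add: "tpart (z + w) = tpart z + tpart w"
  by (simp add: tpart_def)

lemma xpart_has_derivative: "(xpart has_derivative xpart) (at z)"
  by (intro linear_imp_has_derivative linearI) (simp_all add: xpart_def vec_eq_iff)

lemma tpart_has_derivative: "(tpart has_derivative tpart) (at z)"
  by (intro linear_imp_has_derivative linearI) (simp_all add: tpart_def)

lemma inner_diag_vector: "v \<bullet> (diag a *v v) = (\<Sum>i\<in>UNIV. a i * (v $ i)\<^sup>2)"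
proof -
  have "(diag a *v v) $ i = a i * v $ i" for i
    by (simp add: matrix_vector_mult_def diag_def if_distrib[of "\<lambda>c. c * _"] cong: if_cong)
  then show ?thesis by (simp add: inner_vec_def power2_eq_square mult_ac)
qed

lemma inner_congruence:
  fixes A :: "real ^ 'n ^ 'm"
  shows "v \<bullet> ((transpose A ** B ** A) *v v) = (A *v v) \<bullet> (B *v (A *v v))"
proof -
  have "(transpose A ** B ** A) *v v = transpose A *v (B *v (A *v v))"
    by (simp only: matrix_vector_mul_assoc matrix_mul_assoc)
  then show ?thesis using dot_lmul_matrix[of v "transpose A" "B *v (A *v v)"]
    by (simp add: vector_transpose_matrix)
qed

lemma Jmat_vector_nth:
  "(Jmat f z *v d) $ i = grad (f i) (xpart z) \<bullet> xpart d - tpart d"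
  by (simp add: matrix_vector_mul_component Jmat_def inner_xpart_tpart)

lemma inner_Pi_x_vector: "d \<bullet> (Pi_x *v d) = xpart d \<bullet> xpart d"
  by (simp add: Pi_x_def inner_diag_vector UNIV_option_conv sum.reindex inner_vec_def[of "xpart _"]
      xpart_nth power2_eq_square)

lemma Pmat_quadratic_form:
  "d \<bullet> (Pmat f L \<tau> \<delta> z *v d) = \<delta> * (d \<bullet> d) + (\<Sum>i\<in>UNIV. L i) * (xpart d \<bullet> xpart d)
    + (1/2) * (\<Sum>i\<in>UNIV. (grad (f i) (xpart z) \<bullet> xpart d - tpart d)\<^sup>2 / omega f \<tau> z i)"
proof -
  have "Pmat f L \<tau> \<delta> z *v d = \<delta> *\<^sub>R d + (\<Sum>i\<in>UNIV. L i) *\<^sub>R (Pi_x *v d)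
      + (1/2) *\<^sub>R ((transpose (Jmat f z) ** Dmat f \<tau> z ** Jmat f z) *v d)"
    by (simp only: Pmat_def matrix_vector_mult_add_rdistrib scaleR_matrix_vector_assoc[symmetric]
        matrix_vector_mul_lid)
  moreover have "d \<bullet> ((transpose (Jmat f z) ** Dmat f \<tau> z ** Jmat f z) *v d)
      = (\<Sum>i\<in>UNIV. (grad (f i) (xpart z) \<bullet> xpart d - tpart d)\<^sup>2 / omega f \<tau> z i)"
    unfolding inner_congruence Dmat_def inner_diag_vector Jmat_vector_nth
    by (simp only: divide_inverse mult.commute)
  ultimately show ?thesis
    by (simp only: inner_add_right inner_scaleR_right inner_Pi_x_vector)
qed

section \<open>The quadratic majorant of the smoothed objective\<close>

lemma Phi_has_derivative:
  assumes C1: "\<And>i. C1 (f i)" and "\<tau> > 0"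
  shows "(Phi f \<tau> has_derivative (\<lambda>h. tpart h + (\<Sum>i\<in>UNIV.
    (1 + residual f z i / omega f \<tau> z i) / 2 * (grad (f i) (xpart z) \<bullet> xpart h - tpart h)))) (at z)"
proof -
  have "((\<lambda>z. smooth_plus \<tau> (f i (xpart z) - tpart z)) has_derivative
      (\<lambda>h. (1 + residual f z i / omega f \<tau> z i) / 2 * (grad (f i) (xpart z) \<bullet> xpart h - tpart h)))
      (at z)" for i
  proof -
    have "((\<lambda>z. f i (xpart z) - tpart z) has_derivative
        (\<lambda>h. grad (f i) (xpart z) \<bullet> xpart h - tpart h)) (at z)"
      by (intro has_derivative_diff tpart_has_derivative
          has_derivative_compose[OF xpart_has_derivative C1_has_derivative[OF C1]])
    from has_derivative_compose[OF this
        smooth_plus_has_field_derivative[OF \<open>\<tau> > 0\<close>, unfolded has_field_derivative_def]]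
    show ?thesis by (simp add: residual_def omega_def)
  qed
  then show ?thesis unfolding Phi_def[abs_def]
    by (intro has_derivative_add tpart_has_derivative has_derivative_sum)
qed

theorem theorem3p5:
  fixes f :: "'m::finite \<Rightarrow> real ^ 'n::finite \<Rightarrow> real"
    and L :: "'m \<Rightarrow> real"
    and \<tau> \<delta> t \<eta> :: real
    and x p :: "real ^ 'n"
  assumes "\<And>i. C1 (f i)"
    and "\<And>i. L i \<ge> 0"
    and "\<And>i y y'. norm (grad (f i) y - grad (f i) y') \<le> L i * norm (y - y')"
    and "\<tau> > 0"
    and "\<delta> > 0"
  defines "z \<equiv> join x t"
    and "d \<equiv> join p \<eta>"
  shows "Phi f \<tau> (z + d)
    \<le> Phi f \<tau> z + grad (Phi f \<tau>) z \<bullet> d + (1/2) * (d \<bullet> (Pmat f L \<tau> \<delta> z *v d))"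
proof -
  define r where "r = residual f z"
  define w where "w = omega f \<tau> z"
  define s where "s i = grad (f i) x \<bullet> p - \<eta>" for i
  have "smooth_plus \<tau> (f i (x + p) - (t + \<eta>))
      \<le> smooth_plus \<tau> (r i) + (1 + r i / w i) / 2 * s i + (s i)\<^sup>2 / (4 * w i) + L i / 2 * (p \<bullet> p)"
    for i
  proof -
    have "f i (x + p) \<le> f i x + grad (f i) x \<bullet> p + L i / 2 * (p \<bullet> p)"
      using assms(1,3) by (rule descent_lemma)
    then have "f i (x + p) - (t + \<eta>) \<le> (r i + s i) + L i / 2 * (p \<bullet> p)"
      by (simp add: r_def s_def residual_def z_def)
    then have "smooth_plus \<tau> (f i (x + p) - (t + \<eta>))
        \<le> smooth_plus \<tau> ((r i + s i) + L i / 2 * (p \<bullet> p))"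
      by (rule smooth_plus_mono)
    also have "\<dots> \<le> smooth_plus \<tau> (r i + s i) + L i / 2 * (p \<bullet> p)"
      using assms(2) by (intro smooth_plus_add_le) simp
    finally show ?thesis
      using smooth_plus_quadratic_majorant[OF \<open>\<tau> > 0\<close>, of "r i" "s i"]
      by (simp add: w_def omega_def r_def)
  qed
  then have "(\<Sum>i\<in>UNIV. smooth_plus \<tau> (f i (x + p) - (t + \<eta>)))
      \<le> (\<Sum>i\<in>UNIV. smooth_plus \<tau> (r i) + (1 + r i / w i) / 2 * s i + (s i)\<^sup>2 / (4 * w i)
          + L i / 2 * (p \<bullet> p))"
    by (rule sum_mono)
  also have "\<dots> = (\<Sum>i\<in>UNIV. smooth_plus \<tau> (r i)) + (\<Sum>i\<in>UNIV. (1 + r i / w i) / 2 * s i)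
      + (1/4) * (\<Sum>i\<in>UNIV. (s i)\<^sup>2 / w i) + (1/2) * (\<Sum>i\<in>UNIV. L i) * (p \<bullet> p)"
    by (simp add: sum.distrib sum_distrib_left sum_distrib_right)
  finally have sum_le: "(\<Sum>i\<in>UNIV. smooth_plus \<tau> (f i (x + p) - (t + \<eta>))) \<le> \<dots>" .
  have "Phi f \<tau> (z + d) = t + \<eta> + (\<Sum>i\<in>UNIV. smooth_plus \<tau> (f i (x + p) - (t + \<eta>)))"
    by (simp add: Phi_def z_def d_def xpart_add tpart_add)
  moreover have "Phi f \<tau> z = t + (\<Sum>i\<in>UNIV. smooth_plus \<tau> (r i))"
    by (simp add: Phi_def z_def r_def residual_def)
  moreover have "grad (Phi f \<tau>) z \<bullet> d = \<eta> + (\<Sum>i\<in>UNIV. (1 + r i / w i) / 2 * s i)"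
    using grad_inner_eq[OF Phi_has_derivative[of f \<tau> z, OF assms(1,4)], of d]
    by (simp add: r_def w_def s_def z_def d_def)
  moreover have "d \<bullet> (Pmat f L \<tau> \<delta> z *v d)
      = \<delta> * (d \<bullet> d) + (\<Sum>i\<in>UNIV. L i) * (p \<bullet> p) + (1/2) * (\<Sum>i\<in>UNIV. (s i)\<^sup>2 / w i)"
    by (simp add: Pmat_quadratic_form w_def s_def z_def d_def)
  moreover have "\<delta> * (d \<bullet> d) \<ge> 0" using \<open>\<delta> > 0\<close> by simp
  ultimately show ?thesis using sum_le by (simp add: algebra_simps)
qed

end
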